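(* Let $n\ge 3$ be an integer and let $\nu_1,\dots,\nu_n$ be the velocity functions of $n$ innocent runners on the unit circle $\mathbb{R}/\mathbb{Z}$, all starting at the same point at time $0$. Then each of the slowest runner (runner $1$) and the fastest runner (runner $n$) is at a distance strictly larger than $2^{-n+1}$ from every other runner at some time. That is, for each $i\in\{1,n\}$ there exists a time $s>0$ (possibly depending on $i$) such that $$\left\|\int_0^s \bigl(\nu_j(t)-\nu_i(t)\bigr)\,dt\right\|_{\mathbb{R}/\mathbb{Z}} > 2^{-n+1}\quad\text{for every } j\in\{1,\dots,n\}\setminus\{i\}.$$
   Context: For $x\in\mathbb{R}$, $\|x\|_{\mathbb{R}/\mathbb{Z}}$ denotes the distance from $x$ to the nearest integer. Runners are indexed by $\{1,\dots,n\}$, and runner $i$ has a velocity function $\nu_i\in L^1_{\mathrm{loc}}(\mathbb{R}_{>0})$, where local integrability includes integrability near $0$, i.e. $\int_0^s|\nu_i(t)|\,dt<\infty$ for every $s>0$. When all runners start at the same point, the position of runner $i$ at time $s$ is $\int_0^s\nu_i(t)\,dt$ modulo $1$ (up to a common translation), and the distance between runners $i$ and $j$ at time $s$ is $\left\|\int_0^s(\nu_j(t)-\nu_i(t))\,dt\right\|_{\mathbb{R}/\mathbb{Z}}$. The $n$ runners are called innocent if (i) $\nu_1<\nu_2<\cdots<\nu_n$ almost everywhere on $\mathbb{R}_{>0}$, and (ii) for every $1\le i<j\le n$, $\int_0^\infty(\nu_j(t)-\nu_i(t))\,dt=\infty$. *)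

theory Defs
  imports "HOL-Analysis.Analysis"
begin

text \<open>Velocities are represented by functions on the whole real line, of which only the restriction
  to the positive reals matters. Everything is taken with respect to Lebesgue measure, so that the
  functions need only be Lebesgue measurable.\<close>

definition dist_nearest_int :: "real \<Rightarrow> real"
  where "dist_nearest_int x = infdist x \<int>"

text \<open>Local integrability includes integrability near 0.\<close>

definition L1_loc_pos :: "(real \<Rightarrow> real) \<Rightarrow> bool"
  where "L1_loc_pos f \<longleftrightarrow> (\<forall>s>0. f absolutely_integrable_on {0<..s})"

text \<open>The second condition uses the extended nonnegative integral; the truncation of negative values
  by \<^const>\<open>ennreal\<close> is harmless, because the integrand is positive almost everywhere by the first
  condition.\<close>

definition innocent :: "nat \<Rightarrow> (nat \<Rightarrow> real \<Rightarrow> real) \<Rightarrow> bool"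
  where "innocent n \<nu> \<longleftrightarrow>
    (AE t in lebesgue. t > 0 \<longrightarrow> strict_mono_on {1..n} (\<lambda>i. \<nu> i t)) \<and>
    (\<forall>i j. 1 \<le> i \<and> i < j \<and> j \<le> n \<longrightarrow>
      (\<integral>\<^sup>+ t\<in>{0<..}. ennreal (\<nu> j t - \<nu> i t) \<partial>lebesgue) = \<infinity>)"

end

theory Submission
  imports Defs
begin

text \<open>
  Fix the slowest or the fastest runner, put \<open>m = n - 1\<close> and \<open>\<delta> = 2\<^sup>-\<^sup>m\<close>, and let
  \<open>f\<^sub>1 < f\<^sub>2 < \<dots> < f\<^sub>m\<close> be the absolute displacements of the other runners relative to this one, listed
  by increasing relative speed. Because the runner is extremal, \<open>f\<^sub>1\<close> and all differences
  \<open>f\<^sub>k\<^sub>+\<^sub>1 - f\<^sub>k\<close> are strictly increasing: over any time interval, \<open>f\<^sub>k\<^sub>+\<^sub>1\<close> gains strictly more than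
  \<open>f\<^sub>k\<close>.

  Call a real number good if it lies in \<open>[z + \<delta>, z + 1 - \<delta>]\<close> for some integer \<open>z\<close>. One builds nested
  time intervals on which more and more of the \<open>f\<^sub>k\<close> are good. On the first, \<open>f\<^sub>1\<close> runs from \<open>\<delta>\<close> to
  \<open>1 - \<delta>\<close>, which is a gain of \<open>1 - 2\<delta>\<close>. If \<open>f\<^sub>k\<close> gains at least \<open>L\<close> on the current interval, then
  \<open>f\<^sub>k\<^sub>+\<^sub>1\<close> gains more than \<open>L\<close>. Its image may be cut by a gap of length \<open>2\<delta>\<close> around an integer, but one
  of the pieces on either side of the gap has length more than \<open>(L - 2\<delta>) / 2\<close>
  (\<open>long_interval_meets_good_set\<close>), and one restricts to the times when \<open>f\<^sub>k\<^sub>+\<^sub>1\<close> lies in that piece. The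
  recursion \<open>L \<mapsto> (L - 2\<delta>) / 2\<close> halves \<open>L + 2\<delta>\<close>, so \<open>f\<^sub>k\<close> gains at least \<open>2\<^sup>1\<^sup>-\<^sup>k - 2\<delta>\<close> on the
  \<open>k\<close>-th interval (\<open>nested_good_intervals\<close>). For \<open>k = m\<close> this bound is exactly \<open>0\<close>, but the gains are
  strict, so the last interval is still nondegenerate. At its midpoint, by strict monotonicity, all
  distances to the integers exceed \<open>\<delta>\<close>.
\<close>

section \<open>Nested intervals avoiding neighbourhoods of the integers\<close>

lemma dist_nearest_int_minus: "dist_nearest_int (- x) = dist_nearest_int x"
proof -
  have "infdist (- x) \<int> \<le> infdist x \<int>" for x :: real
  proof -
    obtain y :: real where y: "y \<in> \<int>" "infdist x \<int> = dist x y"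
      using infdist_attains_inf[of "\<int> :: real set" x] by (metis Ints_0 closed_Ints empty_iff)
    have "infdist (- x) \<int> \<le> dist (- x) (- y)"
      using y by (intro infdist_le) auto
    then show ?thesis using y by (simp add: dist_minus)
  qed
  from this[of x] this[of "- x"] show ?thesis
    unfolding dist_nearest_int_def by simp
qed

lemma dist_nearest_int_gt:
  fixes x d :: real and z :: int
  assumes "of_int z + d < x" "x < of_int z + 1 - d"
  shows "dist_nearest_int x > d"
proof -
  obtain y :: real where y: "y \<in> \<int>" "infdist x \<int> = dist x y"
    using infdist_attains_inf[of "\<int> :: real set" x] by (metis Ints_0 closed_Ints empty_iff)
  then obtain w :: int where w: "y = of_int w" by (auto elim: Ints_cases)
  have "w \<le> z \<or> w \<ge> z + 1" by linarith
  then have "y \<le> of_int z \<or> y \<ge> of_int z + 1"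
    unfolding w by (metis of_int_1 of_int_add of_int_le_iff)
  then have "dist x y > d" using assms by (auto simp: dist_real_def)
  then show ?thesis using y by (simp add: dist_nearest_int_def)
qed

text \<open>The first gap that ends beyond \<open>u\<close> splits the interval into two good pieces (the left one may be
  empty) of total length at least \<open>v - u - 2d\<close>, unless the interval ends before the gap or reaches beyond the whole
  good interval that follows it; both exceptions leave a piece that is even longer.\<close>

lemma long_interval_meets_good_set:
  fixes u v d L :: real
  assumes d: "0 \<le> d" and uv: "v - u > L" and L: "2 * d \<le> L" "L \<le> 1 - 2 * d"
  obtains u' v' and z :: int where "u \<le> u'" "u' < v'" "v' \<le> v" "of_int z + d \<le> u'"
    "v' \<le> of_int z + 1 - d" "v' - u' > (L - 2 * d) / 2"
proof -
  \<comment> \<open>The first gap ending beyond \<open>u\<close> is the one around \<open>z + 1\<close>.\<close>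
  define z where "z = \<lfloor>u - d\<rfloor>"
  have z: "of_int z + d \<le> u" "u < of_int z + 1 + d"
    unfolding z_def by linarith+
  consider "v \<ge> of_int z + 2 - d" | "v \<le> of_int z + 1 - d"
    | "v < of_int z + 2 - d" "of_int z + 1 - d - u > (L - 2 * d) / 2" "v > of_int z + 1 - d"
    | "v < of_int z + 2 - d" "v - (of_int z + 1 + d) > (L - 2 * d) / 2"
    using uv by argo
  then show ?thesis
  proof cases
    case 1
    show ?thesis
    proof (rule that[of "of_int z + 1 + d" "of_int z + 2 - d" "z + 1"])
    qed (use 1 z d uv L in \<open>simp_all add: field_simps\<close>)
  next
    case 2
    show ?thesis
    proof (rule that[of u v z])
    qed (use 2 z d uv L in \<open>simp_all add: field_simps\<close>)
  next
    case 3
    show ?thesis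
    proof (rule that[of u "of_int z + 1 - d" z])
    qed (use 3 z d uv L in \<open>simp_all add: field_simps\<close>)
  next
    case 4
    show ?thesis
    proof (rule that[of "of_int z + 1 + d" v "z + 1"])
    qed (use 4 z d uv L in \<open>simp_all add: field_simps\<close>)
  qed
qed

text \<open>The hypotheses on \<open>f\<close> describe displacements of runners relative to an extremal one. Being good
  on the whole interval is recorded by its endpoints only, since each \<open>f j\<close> is monotone.\<close>

lemma nested_good_intervals:
  fixes f :: "nat \<Rightarrow> real \<Rightarrow> real" and d :: real
  assumes cont: "\<And>k b. 1 \<le> k \<Longrightarrow> k \<le> m \<Longrightarrow> continuous_on {0..b} (f k)"
    and zero: "f 1 0 = 0" and reach: "0 \<le> T" "f 1 T \<ge> 1"
    and mono: "\<And>k s t. 1 \<le> k \<Longrightarrow> k \<le> m \<Longrightarrow> 0 \<le> s \<Longrightarrow> s < t \<Longrightarrow> f k s < f k t"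
    and gain: "\<And>k s t. 1 \<le> k \<Longrightarrow> k < m \<Longrightarrow> 0 \<le> s \<Longrightarrow> s < t \<Longrightarrow>
      f k t - f k s < f (Suc k) t - f (Suc k) s"
    and d: "0 < d" "d < 1/2" "d \<le> (1/2) ^ m"
    and k: "1 \<le> k" "k \<le> m"
  shows "\<exists>a b. 0 \<le> a \<and> a < b \<and> f k b - f k a \<ge> 2 * (1/2) ^ k - 2 * d \<and>
    (\<forall>j\<in>{1..k}. \<exists>z::int. of_int z + d \<le> f j a \<and> f j b \<le> of_int z + 1 - d)"
  using k
proof (induction k rule: dec_induct)
  case base
  have c: "continuous_on {0..T} (f 1)" using cont base by simp
  obtain a where a: "0 \<le> a" "a \<le> T" "f 1 a = d"
    using IVT'[of "f 1" 0 d T] c reach zero d by auto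
  obtain b where b: "0 \<le> b" "b \<le> T" "f 1 b = 1 - d"
    using IVT'[of "f 1" 0 "1 - d" T] c reach zero d by auto
  have "a < b"
  proof (rule ccontr)
    assume "\<not> a < b"
    then have "f 1 b \<le> f 1 a"
      using mono[of 1 b a] base b by (cases "a = b") auto
    then show False using a b d by simp
  qed
  then show ?case using a b
    by (intro exI[of _ a] exI[of _ b]) (auto intro!: exI[of _ 0])
next
  case (step k)
  then obtain a b where ab: "0 \<le> a" "a < b" and g: "f k b - f k a \<ge> 2 * (1/2) ^ k - 2 * d"
    and good: "\<And>j. j \<in> {1..k} \<Longrightarrow> \<exists>z::int. of_int z + d \<le> f j a \<and> f j b \<le> of_int z + 1 - d"
    by auto
  let ?h = "f (Suc k)" and ?L = "2 * (1/2) ^ k - 2 * d :: real"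
  have h: "?h b - ?h a > ?L"
    using gain[of k a b] step ab g by simp
  have "(1/2 :: real) ^ m \<le> (1/2) ^ Suc k"
    using step by (intro power_decreasing) auto
  then have L1: "2 * d \<le> ?L" using d by simp
  have "(1/2 :: real) ^ k \<le> (1/2) ^ 1"
    using step by (intro power_decreasing) auto
  then have L2: "?L \<le> 1 - 2 * d" by simp
  obtain u v and z :: int where uv: "?h a \<le> u" "u < v" "v \<le> ?h b"
    "of_int z + d \<le> u" "v \<le> of_int z + 1 - d" "v - u > (?L - 2 * d) / 2"
    using long_interval_meets_good_set[of d ?L "?h b" "?h a"] h L1 L2 d by auto
  have c: "continuous_on {a..b} ?h"
    using cont[of "Suc k" b] step ab by (auto intro: continuous_on_subset)
  obtain a' where a': "a \<le> a'" "a' \<le> b" "?h a' = u"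
    using IVT'[of ?h a u b] c uv ab by auto
  obtain b' where b': "a \<le> b'" "b' \<le> b" "?h b' = v"
    using IVT'[of ?h a v b] c uv ab by auto
  have mono': "f j s \<le> f j t" if "1 \<le> j" "j \<le> m" "0 \<le> s" "s \<le> t" for j s t
    using mono[of j s t] that by (cases "s = t") auto
  have "a' < b'"
    using mono'[of "Suc k" b' a'] a' b' uv ab step by (cases "a' < b'") auto
  moreover have "?h b' - ?h a' \<ge> 2 * (1/2) ^ Suc k - 2 * d"
    using uv a' b' by (simp add: field_simps)
  moreover have "\<exists>z::int. of_int z + d \<le> f j a' \<and> f j b' \<le> of_int z + 1 - d"
    if j: "j \<in> {1..Suc k}" for j
  proof (cases "j = Suc k")
    case True
    then show ?thesis using uv a' b' by auto
  next
    case False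
    then have jk: "j \<in> {1..k}" using j by auto
    then obtain z :: int where "of_int z + d \<le> f j a" "f j b \<le> of_int z + 1 - d"
      using good by blast
    moreover have "f j a \<le> f j a'" "f j b' \<le> f j b"
      using mono'[of j] jk step a' b' ab by auto
    ultimately show ?thesis by (intro exI[of _ z]) linarith
  qed
  ultimately show ?case using a' ab by (intro exI[of _ a'] exI[of _ b']) auto
qed

lemma exists_time_far_from_integers:
  fixes f :: "nat \<Rightarrow> real \<Rightarrow> real"
  assumes m: "2 \<le> m"
    and cont: "\<And>k b. 1 \<le> k \<Longrightarrow> k \<le> m \<Longrightarrow> continuous_on {0..b} (f k)"
    and zero: "f 1 0 = 0" and reach: "0 \<le> T" "f 1 T \<ge> 1"
    and mono: "\<And>k s t. 1 \<le> k \<Longrightarrow> k \<le> m \<Longrightarrow> 0 \<le> s \<Longrightarrow> s < t \<Longrightarrow> f k s < f k t"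
    and gain: "\<And>k s t. 1 \<le> k \<Longrightarrow> k < m \<Longrightarrow> 0 \<le> s \<Longrightarrow> s < t \<Longrightarrow>
      f k t - f k s < f (Suc k) t - f (Suc k) s"
  shows "\<exists>s>0. \<forall>k\<in>{1..m}. dist_nearest_int (f k s) > (1/2) ^ m"
proof -
  have "(1/2 :: real) ^ m \<le> (1/2) ^ 2" using m by (intro power_decreasing) auto
  then have d: "(1/2 :: real) ^ m < 1/2" by (simp add: power2_eq_square)
  obtain a b where ab: "0 \<le> a" "a < b" and good: "\<And>j. j \<in> {1..m} \<Longrightarrow>
      \<exists>z::int. of_int z + (1/2) ^ m \<le> f j a \<and> f j b \<le> of_int z + 1 - (1/2) ^ m"
    using nested_good_intervals[of m f T "(1/2) ^ m" m, OF cont zero reach mono gain] d m by auto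
  define s where "s = (a + b) / 2"
  have s: "a < s" "s < b" using ab by (auto simp: s_def)
  have "dist_nearest_int (f k s) > (1/2) ^ m" if k: "k \<in> {1..m}" for k
  proof -
    obtain z :: int where "of_int z + (1/2) ^ m \<le> f k a" "f k b \<le> of_int z + 1 - (1/2) ^ m"
      using good[OF k] by blast
    moreover have "f k a < f k s" "f k s < f k b" using mono[of k] k s ab by auto
    ultimately show ?thesis by (intro dist_nearest_int_gt[of z]) auto
  qed
  then show ?thesis using s ab by (intro exI[of _ s]) auto
qed

section \<open>Displacements with positive relative velocity\<close>

lemma L1_loc_pos_diff: "L1_loc_pos f \<Longrightarrow> L1_loc_pos g \<Longrightarrow> L1_loc_pos (\<lambda>t. f t - g t)"
  unfolding L1_loc_pos_def by (auto intro: set_integral_diff)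

lemma L1_loc_pos_integrable:
  assumes "L1_loc_pos g" "0 \<le> s"
  shows "set_integrable lebesgue {0<..s} g"
  using assms by (cases "s = 0") (auto simp: L1_loc_pos_def)

lemma displacement_continuous:
  assumes g: "L1_loc_pos g"
  shows "continuous_on {0..b} (\<lambda>s. LINT t:{0<..s}|lebesgue. g t)"
proof (cases "0 \<le> b")
  case True
  have eq: "(LINT t:{0<..s}|lebesgue. g t) = integral {0..s} g" if "s \<in> {0..b}" for s
  proof -
    have "(LINT t:{0<..s}|lebesgue. g t) = integral {0<..s} g"
      using L1_loc_pos_integrable[OF g] that by (intro set_lebesgue_integral_eq_integral) auto
    also have "\<dots> = integral {0..s} g"
      by (rule integral_spike_set; rule negligible_subset[of "{0}"]) auto
    finally show ?thesis .
  qed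
  have "g integrable_on {0<..b}"
    using L1_loc_pos_integrable[OF g True] by (rule set_lebesgue_integral_eq_integral)
  then have "g integrable_on {0..b}"
  proof (rule integrable_spike_set)
    show "negligible {x \<in> {0<..b} - {0..b}. g x \<noteq> 0}"
      by (rule negligible_subset[of "{0}"]) auto
    show "negligible {x \<in> {0..b} - {0<..b}. g x \<noteq> 0}"
      by (rule negligible_subset[of "{0}"]) auto
  qed
  then have "continuous_on {0..b} (\<lambda>s. integral {0..s} g)"
    by (rule indefinite_integral_continuous_1)
  then show ?thesis using eq by (subst continuous_on_cong[OF refl eq])
qed auto

lemma displacement_strict_mono:
  assumes g: "L1_loc_pos g" and pos: "AE t in lebesgue. t > 0 \<longrightarrow> 0 < g t"
    and st: "0 \<le> s" "s < t"
  shows "(LINT t:{0<..s}|lebesgue. g t) < (LINT u:{0<..t}|lebesgue. g u)"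
proof -
  have int: "set_integrable lebesgue {0<..s} g" "set_integrable lebesgue {0<..t} g"
    using L1_loc_pos_integrable[OF g] st by auto
  let ?w = "\<lambda>u. indicator {0<..t} u *\<^sub>R g u - indicator {0<..s} u *\<^sub>R g u"
  have w: "integrable lebesgue ?w"
    using int unfolding set_integrable_def by (intro Bochner_Integration.integrable_diff)
  have nonneg: "AE u in lebesgue. 0 \<le> ?w u"
    using pos by eventually_elim (use st in \<open>auto simp: indicator_def\<close>)
  have "integral\<^sup>L lebesgue ?w \<noteq> 0"
  proof
    assume "integral\<^sup>L lebesgue ?w = 0"
    then have "AE u in lebesgue. ?w u = 0"
      using integral_nonneg_eq_0_iff_AE[OF w nonneg] by simp
    with pos have "AE u in lebesgue. u \<notin> {s<..t}"
      by eventually_elim (use st in \<open>auto simp: indicator_def split: if_splits\<close>)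
    then have "{s<..t} \<in> null_sets lebesgue"
      by (subst AE_iff_null_sets) auto
    then show False using st by (simp add: null_sets_def)
  qed
  moreover have "integral\<^sup>L lebesgue ?w \<ge> 0"
    using nonneg by (rule integral_nonneg_AE)
  moreover have "integral\<^sup>L lebesgue ?w = (LINT u|lebesgue. indicator {0<..t} u *\<^sub>R g u)
      - (LINT u|lebesgue. indicator {0<..s} u *\<^sub>R g u)"
    using int unfolding set_integrable_def by (intro Bochner_Integration.integral_diff)
  ultimately have "(LINT u|lebesgue. indicator {0<..s} u *\<^sub>R g u)
      < (LINT u|lebesgue. indicator {0<..t} u *\<^sub>R g u)"
    by linarith
  then show ?thesis unfolding set_lebesgue_integral_def .
qed

text \<open>If the displacement never reached \<open>1\<close>, then by monotone convergence the total integral would be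
  at most \<open>1\<close>.\<close>

lemma displacement_reaches_1:
  assumes g: "L1_loc_pos g" and pos: "AE t in lebesgue. t > 0 \<longrightarrow> 0 < g t"
    and inf: "(\<integral>\<^sup>+ t\<in>{0<..}. ennreal (g t) \<partial>lebesgue) = \<infinity>"
  shows "\<exists>T\<ge>0. (LINT t:{0<..T}|lebesgue. g t) \<ge> 1"
proof (rule ccontr)
  assume contr: "\<not> ?thesis"
  let ?F = "\<lambda>(k::nat) t. ennreal (g t) * indicator {0<..real k} t"
  have int: "integrable lebesgue (\<lambda>t. indicator {0<..real k} t *\<^sub>R g t)" for k :: nat
    using L1_loc_pos_integrable[OF g, of "real k"] by (simp add: set_integrable_def)
  have F: "?F k = (\<lambda>t. ennreal (indicator {0<..real k} t *\<^sub>R g t))" for k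
    by (auto simp: indicator_def)
  have le: "integral\<^sup>N lebesgue (?F k) \<le> 1" for k
  proof -
    have "integral\<^sup>N lebesgue (?F k) = ennreal (LINT t|lebesgue. indicator {0<..real k} t *\<^sub>R g t)"
      unfolding F
    proof (rule nn_integral_eq_integral[OF int])
      show "AE t in lebesgue. 0 \<le> indicator {0<..real k} t *\<^sub>R g t"
        using pos by eventually_elim (auto simp: indicator_def)
    qed
    also have "\<dots> \<le> ennreal 1"
    proof (rule ennreal_leI)
      have "\<not> (LINT t:{0<..real k}|lebesgue. g t) \<ge> 1"
        using contr of_nat_0_le_iff by blast
      then show "(LINT t|lebesgue. indicator {0<..real k} t *\<^sub>R g t) \<le> 1"
        unfolding set_lebesgue_integral_def by linarith
    qed
    finally show ?thesis by simp
  qed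
  have "(SUP k. ?F k t) = ennreal (g t) * indicator {0<..} t" for t
  proof -
    obtain k :: nat where k: "t \<le> real k" using real_arch_simple by blast
    show ?thesis
    proof (rule antisym)
      show "(SUP k. ?F k t) \<le> ennreal (g t) * indicator {0<..} t"
        by (intro SUP_least) (auto simp: indicator_def)
      show "ennreal (g t) * indicator {0<..} t \<le> (SUP k. ?F k t)"
        using k by (intro SUP_upper2[of k]) (auto simp: indicator_def)
    qed
  qed
  then have "(\<integral>\<^sup>+ t\<in>{0<..}. ennreal (g t) \<partial>lebesgue) = (\<integral>\<^sup>+ t. (SUP k. ?F k t) \<partial>lebesgue)"
    by simp
  also have "\<dots> = (SUP k. integral\<^sup>N lebesgue (?F k))"
  proof (rule nn_integral_monotone_convergence_SUP)
    show "incseq ?F"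
      by (auto simp: incseq_def le_fun_def indicator_def)
    show "?F k \<in> borel_measurable lebesgue" for k
      unfolding F by (intro measurable_compose[OF borel_measurable_integrable[OF int]]) auto
  qed
  also have "\<dots> \<le> 1" using le by (intro SUP_least)
  finally show False using inf by (simp add: top_unique)
qed

text \<open>Runner \<open>p 0\<close> is the extremal one, and \<open>p\<close> lists the runners by increasing difference of velocity
  from it; the sign \<open>\<sigma>\<close> is \<open>1\<close> if it is the slowest and \<open>-1\<close> if it is the fastest, so that
  \<open>\<sigma> * (\<nu> (p k) t - \<nu> (p j) t)\<close> is positive for \<open>j < k\<close> in both cases.\<close>

lemma extremal_runner_lonely:
  fixes \<nu> :: "nat \<Rightarrow> real \<Rightarrow> real" and p :: "nat \<Rightarrow> nat" and \<sigma> :: real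
  assumes m: "2 \<le> m" and \<sigma>: "\<sigma> = 1 \<or> \<sigma> = -1"
    and L1: "\<And>k. k \<le> m \<Longrightarrow> L1_loc_pos (\<nu> (p k))"
    and pos: "\<And>j k. j < k \<Longrightarrow> k \<le> m \<Longrightarrow>
      AE t in lebesgue. t > 0 \<longrightarrow> 0 < \<sigma> * (\<nu> (p k) t - \<nu> (p j) t)"
    and inf: "(\<integral>\<^sup>+ t\<in>{0<..}. ennreal (\<sigma> * (\<nu> (p 1) t - \<nu> (p 0) t)) \<partial>lebesgue) = \<infinity>"
  shows "\<exists>s>0. \<forall>k\<in>{1..m}.
    dist_nearest_int (LINT t:{0<..s}|lebesgue. \<nu> (p k) t - \<nu> (p 0) t) > (1/2) ^ m"
proof -
  define D where "D j k s = (LINT t:{0<..s}|lebesgue. \<sigma> * (\<nu> (p k) t - \<nu> (p j) t))" for j k s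
  have L1': "L1_loc_pos (\<lambda>t. \<sigma> * (\<nu> (p k) t - \<nu> (p j) t))" if "j \<le> m" "k \<le> m" for j k
    using L1_loc_pos_diff[OF L1 L1, of j k] L1_loc_pos_diff[OF L1 L1, of k j] that \<sigma> by auto
  have D_mono: "D j k s < D j k t" if "j < k" "k \<le> m" "0 \<le> s" "s < t" for j k s t
    unfolding D_def using that by (intro displacement_strict_mono L1' pos) auto
  have D_add: "D 0 (Suc k) s = D 0 k s + D k (Suc k) s" if "k < m" "0 \<le> s" for k s
  proof -
    have "D 0 k s + D k (Suc k) s = (LINT t:{0<..s}|lebesgue.
      \<sigma> * (\<nu> (p k) t - \<nu> (p 0) t) + \<sigma> * (\<nu> (p (Suc k)) t - \<nu> (p k) t))"
      unfolding D_def using that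
      by (intro set_integral_add(2)[symmetric] L1_loc_pos_integrable L1') auto
    then show ?thesis unfolding D_def by (simp add: algebra_simps)
  qed
  obtain T where T: "0 \<le> T" "D 0 1 T \<ge> 1"
    using displacement_reaches_1[OF L1' pos, of 0 1] inf m unfolding D_def by auto
  have "\<exists>s>0. \<forall>k\<in>{1..m}. dist_nearest_int (D 0 k s) > (1/2) ^ m"
  proof (rule exists_time_far_from_integers[where T = T])
    show "continuous_on {0..b} (D 0 k)" if "1 \<le> k" "k \<le> m" for k b
      using displacement_continuous[OF L1', of 0 k b] that unfolding D_def by auto
    show "2 \<le> m" "0 \<le> T" "D 0 1 T \<ge> 1" using m T by auto
    show "D 0 1 0 = 0" by (simp add: D_def set_lebesgue_integral_def)
    show "D 0 k s < D 0 k t" if "1 \<le> k" "k \<le> m" "0 \<le> s" "s < t" for k s t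
      using D_mono that by auto
    show "D 0 k t - D 0 k s < D 0 (Suc k) t - D 0 (Suc k) s"
      if "1 \<le> k" "k < m" "0 \<le> s" "s < t" for k s t
      using D_add[of k s] D_add[of k t] D_mono[of k "Suc k" s t] that by auto
  qed
  moreover have "dist_nearest_int (D 0 k s) =
    dist_nearest_int (LINT t:{0<..s}|lebesgue. \<nu> (p k) t - \<nu> (p 0) t)" for k s
    unfolding D_def set_integral_mult_right using \<sigma> by (auto simp: dist_nearest_int_minus)
  ultimately show ?thesis by simp
qed

theorem theorem1p3:
  fixes n :: nat and \<nu> :: "nat \<Rightarrow> real \<Rightarrow> real"
  assumes "n \<ge> 3"
    and "\<And>i. i \<in> {1..n} \<Longrightarrow> L1_loc_pos (\<nu> i)"
    and "innocent n \<nu>"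
  shows "\<forall>i\<in>{1, n}. \<exists>s>0. \<forall>j\<in>{1..n} - {i}.
    dist_nearest_int (LINT t:{0<..s}|lebesgue. \<nu> j t - \<nu> i t) > 2 powi (- int n + 1)"
proof -
  have pos: "AE t in lebesgue. t > 0 \<longrightarrow> \<nu> i t < \<nu> j t" if "1 \<le> i" "i < j" "j \<le> n" for i j
  proof -
    have "AE t in lebesgue. t > 0 \<longrightarrow> strict_mono_on {1..n} (\<lambda>i. \<nu> i t)"
      using assms(3) by (simp add: innocent_def)
    then show ?thesis
      by eventually_elim (use that in \<open>auto simp: strict_mono_on_def\<close>)
  qed
  have inf: "(\<integral>\<^sup>+ t\<in>{0<..}. ennreal (\<nu> j t - \<nu> i t) \<partial>lebesgue) = \<infinity>"
    if "1 \<le> i" "i < j" "j \<le> n" for i j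
    using assms(3) that by (auto simp: innocent_def)
  have "- int n + 1 = - int (n - 1)" using assms(1) by simp
  then have pw: "(2::real) powi (- int n + 1) = (1/2) ^ (n - 1)"
    by (simp only: power_int_minus power_int_of_nat) (simp add: power_one_over inverse_eq_divide)
  have slow: "\<exists>s>0. \<forall>k\<in>{1..n-1}.
    dist_nearest_int (LINT t:{0<..s}|lebesgue. \<nu> (k + 1) t - \<nu> (0 + 1) t) > (1/2) ^ (n - 1)"
  proof (rule extremal_runner_lonely[where \<sigma> = 1])
    show "AE t in lebesgue. t > 0 \<longrightarrow> 0 < 1 * (\<nu> (k + 1) t - \<nu> (j + 1) t)"
      if "j < k" "k \<le> n - 1" for j k
      using pos[of "j + 1" "k + 1"] that by auto
  qed (use assms inf[of 1 2] in \<open>auto simp: numeral_2_eq_2\<close>)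
  have fast: "\<exists>s>0. \<forall>k\<in>{1..n-1}.
    dist_nearest_int (LINT t:{0<..s}|lebesgue. \<nu> (n - k) t - \<nu> (n - 0) t) > (1/2) ^ (n - 1)"
  proof (rule extremal_runner_lonely[where \<sigma> = "-1"])
    show "AE t in lebesgue. t > 0 \<longrightarrow> 0 < - 1 * (\<nu> (n - k) t - \<nu> (n - j) t)"
      if "j < k" "k \<le> n - 1" for j k
      using pos[of "n - k" "n - j"] that assms(1) by auto
  qed (use assms inf[of "n - 1" n] in auto)
  show ?thesis
  proof
    fix i assume "i \<in> {1, n}"
    then consider "i = 1" | "i = n" by auto
    then show "\<exists>s>0. \<forall>j\<in>{1..n} - {i}.
      dist_nearest_int (LINT t:{0<..s}|lebesgue. \<nu> j t - \<nu> i t) > 2 powi (- int n + 1)"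
    proof cases
      case 1
      obtain s where s: "s > 0" "\<And>k. k \<in> {1..n-1} \<Longrightarrow>
        dist_nearest_int (LINT t:{0<..s}|lebesgue. \<nu> (k + 1) t - \<nu> 1 t) > (1/2) ^ (n - 1)"
        using slow by auto
      have "dist_nearest_int (LINT t:{0<..s}|lebesgue. \<nu> j t - \<nu> 1 t) > (1/2) ^ (n - 1)"
        if "j \<in> {1..n} - {1}" for j
      proof -
        have "j - 1 \<in> {1..n-1}" "j - 1 + 1 = j" using that by auto
        then show ?thesis using s(2)[of "j - 1"] by metis
      qed
      then show ?thesis unfolding pw 1 using s(1) by blast
    next
      case 2
      obtain s where s: "s > 0" "\<And>k. k \<in> {1..n-1} \<Longrightarrow>
        dist_nearest_int (LINT t:{0<..s}|lebesgue. \<nu> (n - k) t - \<nu> n t) > (1/2) ^ (n - 1)"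
        using fast by auto
      have "dist_nearest_int (LINT t:{0<..s}|lebesgue. \<nu> j t - \<nu> n t) > (1/2) ^ (n - 1)"
        if "j \<in> {1..n} - {n}" for j
      proof -
        have "n - j \<in> {1..n-1}" "n - (n - j) = j" using that by auto
        then show ?thesis using s(2)[of "n - j"] by metis
      qed
      then show ?thesis unfolding pw 2 using s(1) by blast
    qed
  qed
qed

end
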